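(* Let $\delta\in\{1,-1\}$ and let $y_1 = x_1^2x_2x_1^{2\delta}x_2^{-1}$ in the free group $F_2$ on $x_1,x_2$; for $k\in\mathbb{Z}$ write $y_k=y_1^k$. Let $\varepsilon\in\{1,-1\}$, let $k$ be an integer, and put $k_\varepsilon = k-\frac12+\frac{\varepsilon}{2}$ (so $k_\varepsilon=k$ if $\varepsilon=1$ and $k_\varepsilon=k-1$ if $\varepsilon=-1$). Assume $k_\varepsilon\ge 1$ and $k_\varepsilon\not\equiv 1\pmod 3$. Let $w$ be either of the words $x_1^{2\varepsilon}y_k$, $x_1^2y_{\varepsilon k}$. If $K$ is a number field whose degree over $\mathbb{Q}$ is coprime to $6$, then the word map $(x,y)\mapsto w(x,y)$ is not surjective on the absolute Galois group $\mathrm{Gal}(\overline{\mathbb{Q}}/K)$ of $K$.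
   Context: A word $w\in F_2=\langle x_1,x_2\rangle$ induces on any group $G$ the word map $G\times G\to G$, $(x,y)\mapsto w(x,y)$, obtained by substituting $x_1=x$, $x_2=y$. Here $\overline{\mathbb{Q}}$ is an algebraic closure of $\mathbb{Q}$ containing $K$. *)

theory Defs
  imports
    "HOL-Algebra.Algebraic_Closure_Type"
    "HOL-Algebra.Finite_Extensions"
    "HOL-Algebra.Bij"
    "HOL-Number_Theory.Cong"
begin

section \<open>Free groups\<close>

text \<open>
  A letter \<open>(g, True)\<close> stands for the generator \<open>g\<close> and \<open>(g, False)\<close> for its inverse.
  The elements of the free group are the reduced words.
\<close>

type_synonym 'g letter = "'g \<times> bool"

definition inv_letter :: "'g letter \<Rightarrow> 'g letter" where
  "inv_letter a = (fst a, \<not> snd a)"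

definition reduced :: "'g letter list \<Rightarrow> bool" where
  "reduced u \<longleftrightarrow> successively (\<lambda>a b. b \<noteq> inv_letter a) u"

text \<open>The reduced form of \<open>a # u\<close>, for reduced \<open>u\<close>:\<close>

definition push :: "'g letter \<Rightarrow> 'g letter list \<Rightarrow> 'g letter list" where
  "push a u = (if u \<noteq> [] \<and> hd u = inv_letter a then tl u else a # u)"

definition free_group :: "'g letter list monoid" where
  "free_group = \<lparr>carrier = {u. reduced u}, monoid.mult = (\<lambda>u v. foldr push u v), one = []\<rparr>"

definition free_gen :: "'g \<Rightarrow> 'g letter list" where
  "free_gen g = [(g, True)]"

definition subst_word ::
  "('a, 'b) monoid_scheme \<Rightarrow> ('g \<Rightarrow> 'a) \<Rightarrow> 'g letter list \<Rightarrow> 'a" where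
  "subst_word G f u =
     foldr (\<lambda>(g, s) z. (if s then f g else inv\<^bsub>G\<^esub> (f g)) \<otimes>\<^bsub>G\<^esub> z) u \<one>\<^bsub>G\<^esub>"

lemma inv_letter_inv_letter [simp]: "inv_letter (inv_letter a) = a"
  by (simp add: inv_letter_def)

lemma reduced_Nil [simp]: "reduced []"
  by (simp add: reduced_def)

lemma reduced_push: "reduced u \<Longrightarrow> reduced (push a u)"
  by (cases u) (auto simp: reduced_def push_def successively_Cons)

lemma reduced_foldr_push: "reduced v \<Longrightarrow> reduced (foldr push u v)"
  by (induction u) (auto simp: reduced_push)

lemma push_cancel: "reduced u \<Longrightarrow> push (inv_letter a) (push a u) = u"
  by (cases u) (auto simp: reduced_def push_def successively_Cons)

lemma foldr_push_push:
  assumes "reduced v"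
  shows "foldr push (push a u) v = push a (foldr push u v)"
proof (cases "u \<noteq> [] \<and> hd u = inv_letter a")
  case True
  then obtain u' where u: "u = inv_letter a # u'"
    by (cases u) auto
  have "push a (push (inv_letter a) (foldr push u' v)) = foldr push u' v"
    using push_cancel[OF reduced_foldr_push[OF assms], of "inv_letter a"] by simp
  then show ?thesis
    by (simp add: u push_def[of a "inv_letter a # u'"])
next
  case False
  then have "push a u = a # u"
    by (auto simp: push_def)
  then show ?thesis
    by simp
qed

lemma foldr_push_assoc:
  "reduced v \<Longrightarrow> reduced w \<Longrightarrow>
     foldr push (foldr push u v) w = foldr push u (foldr push v w)"
  by (induction u) (auto simp: foldr_push_push)

lemma foldr_push_inverse: "foldr push (rev (map inv_letter u)) u = []"
  by (induction u) (auto simp: push_def)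

lemma reduced_rev_inverse: "reduced u \<Longrightarrow> reduced (rev (map inv_letter u))"
  unfolding reduced_def by (auto simp: successively_map elim!: successively_mono)

lemma group_free_group: "group free_group"
proof (rule groupI)
  fix u :: "'g letter list"
  assume "u \<in> carrier free_group"
  then show "\<exists>v\<in>carrier free_group. v \<otimes>\<^bsub>free_group\<^esub> u = \<one>\<^bsub>free_group\<^esub>"
    by (intro bexI[of _ "rev (map inv_letter u)"])
       (auto simp: free_group_def foldr_push_inverse reduced_rev_inverse)
qed (auto simp: free_group_def reduced_foldr_push foldr_push_assoc)

lemma free_gen_closed: "free_gen g \<in> carrier free_group"
  by (simp add: free_gen_def free_group_def reduced_def)

context group
begin

lemma subst_word_Nil [simp]: "subst_word G f [] = \<one>"
  by (simp add: subst_word_def)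

lemma subst_word_Cons:
  "subst_word G f (a # u) = (if snd a then f (fst a) else inv (f (fst a))) \<otimes> subst_word G f u"
  by (cases a) (simp add: subst_word_def)

lemma subst_word_closed: "range f \<subseteq> carrier G \<Longrightarrow> subst_word G f u \<in> carrier G"
  by (induction u) (auto simp: subst_word_Cons)

lemma subst_word_push:
  assumes f: "range f \<subseteq> carrier G"
  shows "subst_word G f (push a u) = subst_word G f (a # u)"
proof (cases "u \<noteq> [] \<and> hd u = inv_letter a")
  case True
  then obtain u' where u: "u = inv_letter a # u'"
    by (cases u) auto
  have "f (fst a) \<in> carrier G" "subst_word G f u' \<in> carrier G"
    using f subst_word_closed[OF f] by auto
  then show ?thesis
    by (auto simp: u push_def subst_word_Cons inv_letter_def m_assoc[symmetric])
next
  case False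
  then have "push a u = a # u"
    by (auto simp: push_def)
  then show ?thesis
    by simp
qed

lemma subst_word_hom:
  assumes f: "range f \<subseteq> carrier G"
  shows "subst_word G f \<in> hom free_group G"
proof (rule homI)
  fix u v :: "'c letter list"
  have "subst_word G f (foldr push u v) = subst_word G f u \<otimes> subst_word G f v"
  proof (induction u)
    case (Cons a u)
    have "f (fst a) \<in> carrier G"
      using f by auto
    then show ?case
      by (simp add: subst_word_push[OF f] subst_word_Cons Cons.IH m_assoc
          subst_word_closed[OF f])
  qed (simp add: subst_word_closed[OF f])
  then show "subst_word G f (u \<otimes>\<^bsub>free_group\<^esub> v) = subst_word G f u \<otimes> subst_word G f v"
    by (simp add: free_group_def)
qed (simp add: subst_word_closed[OF f])

lemma subst_word_free_gen: "range f \<subseteq> carrier G \<Longrightarrow> subst_word G f (free_gen g) = f g"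
  by (simp add: free_gen_def subst_word_Cons image_subset_iff)

end


section \<open>The free group of rank two and word maps\<close>

datatype gen2 = Gen1 | Gen2

abbreviation F2 :: "gen2 letter list monoid" where
  "F2 \<equiv> free_group"

abbreviation x1 :: "gen2 letter list" where
  "x1 \<equiv> free_gen Gen1"

abbreviation x2 :: "gen2 letter list" where
  "x2 \<equiv> free_gen Gen2"

definition word_map ::
  "('a, 'b) monoid_scheme \<Rightarrow> gen2 letter list \<Rightarrow> 'a \<times> 'a \<Rightarrow> 'a" where
  "word_map G w = (\<lambda>(x, y). subst_word G (case_gen2 x y) w)"

definition y_word :: "int \<Rightarrow> int \<Rightarrow> gen2 letter list" where
  "y_word \<delta> k =
     (x1 [^]\<^bsub>F2\<^esub> (2::int) \<otimes>\<^bsub>F2\<^esub> x2 \<otimes>\<^bsub>F2\<^esub> x1 [^]\<^bsub>F2\<^esub> (2 * \<delta>) \<otimes>\<^bsub>F2\<^esub> inv\<^bsub>F2\<^esub> x2) [^]\<^bsub>F2\<^esub> k"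


section \<open>Number fields and Galois groups\<close>

text \<open>
  Number fields are taken inside an ambient field of characteristic 0, in which \<open>\<rat>\<close> is the
  set of rational numbers.
\<close>

definition number_field :: "'a::field_char_0 set \<Rightarrow> bool" where
  "number_field K \<longleftrightarrow>
     subfield K ring_of_type_algebra \<and> ring.finite_dimension ring_of_type_algebra \<rat> K"

definition degree_over_Q :: "'a::field_char_0 set \<Rightarrow> nat" where
  "degree_over_Q K = ring.dim ring_of_type_algebra \<rat> K"

text \<open>The group \<open>Aut(L/K)\<close> under composition, which is \<open>Gal(L/K)\<close> when \<open>L/K\<close> is Galois.\<close>

definition galois_group :: "('a, 'b) ring_scheme \<Rightarrow> 'a set \<Rightarrow> ('a \<Rightarrow> 'a) monoid" where
  "galois_group L K = (BijGroup (carrier L))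
     \<lparr>carrier := {\<sigma> \<in> Bij (carrier L). \<sigma> \<in> ring_hom L L \<and> (\<forall>x\<in>K. \<sigma> x = x)}\<rparr>"

lemma group_galois_group:
  assumes "ring L" "K \<subseteq> carrier L"
  shows "group (galois_group L K)"
proof -
  interpret L: ring L by fact
  interpret B: group "BijGroup (carrier L)" by (rule group_BijGroup)
  have "subgroup {\<sigma> \<in> Bij (carrier L). \<sigma> \<in> ring_hom L L \<and> (\<forall>x\<in>K. \<sigma> x = x)}
          (BijGroup (carrier L))" (is "subgroup ?A _")
  proof (rule B.subgroupI)
    show "?A \<subseteq> carrier (BijGroup (carrier L))"
      by (auto simp: BijGroup_def)
    have "(\<lambda>x\<in>carrier L. x) \<in> ?A"
      using assms(2) by (auto simp: id_Bij ring_hom_def)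
    then show "?A \<noteq> {}"
      by blast
  next
    fix f assume f: "f \<in> ?A"
    then have fB: "f \<in> Bij (carrier L)" and fr: "f \<in> ring_hom L L" and fK: "\<And>x. x \<in> K \<Longrightarrow> f x = x"
      by auto
    have bij: "bij_betw f (carrier L) (carrier L)"
      using fB by (simp add: Bij_def)
    let ?g = "\<lambda>x\<in>carrier L. inv_into (carrier L) f x"
    have inv: "inv_into (carrier L) f (f x) = x" if "x \<in> carrier L" for x
      using bij that by (simp add: bij_betw_def)
    have "?g \<in> ring_hom L L"
    proof (rule ring_hom_memI)
      show "?g \<one>\<^bsub>L\<^esub> = \<one>\<^bsub>L\<^esub>"
        using inv[of "\<one>\<^bsub>L\<^esub>"] ring_hom_one[OF fr] by simp
    next
      fix x y assume xy: "x \<in> carrier L" "y \<in> carrier L"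
      then show "?g (x \<otimes>\<^bsub>L\<^esub> y) = ?g x \<otimes>\<^bsub>L\<^esub> ?g y"
        using Bij_inv_into_lemma[of "carrier L" f "\<lambda>x y. x \<otimes>\<^bsub>L\<^esub> y" x y] fB
        by (simp add: ring_hom_mult[OF fr] Pi_def)
      show "?g (x \<oplus>\<^bsub>L\<^esub> y) = ?g x \<oplus>\<^bsub>L\<^esub> ?g y"
        using Bij_inv_into_lemma[of "carrier L" f "\<lambda>x y. x \<oplus>\<^bsub>L\<^esub> y" x y] fB xy
        by (simp add: ring_hom_add[OF fr] Pi_def)
    qed (use fB in \<open>auto intro: Bij_inv_into_mem\<close>)
    moreover have "?g x = x" if "x \<in> K" for x
      using inv[of x] fK[OF that] that assms(2) by auto
    ultimately show "inv\<^bsub>BijGroup (carrier L)\<^esub> f \<in> ?A"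
      using fB by (simp add: inv_BijGroup restrict_inv_into_Bij)
  next
    fix f g assume fg: "f \<in> ?A" "g \<in> ?A"
    have "compose (carrier L) f g \<in> ring_hom L L"
      using fg by (auto simp: ring_hom_def compose_def Pi_def)
    moreover have "compose (carrier L) f g x = x" if "x \<in> K" for x
      using fg that assms(2) by (auto simp: compose_def)
    ultimately show "f \<otimes>\<^bsub>BijGroup (carrier L)\<^esub> g \<in> ?A"
      using fg by (auto simp: BijGroup_def compose_Bij)
  qed
  then show ?thesis
    unfolding galois_group_def by (rule B.subgroup_imp_group)
qed

end

theory Submission
  imports Defs
begin

text \<open>
  Every exponent of \<open>x\<^sub>1\<close> in \<open>w\<close> is even, so \<open>w(x, y)\<close> is a product of conjugates of squares and
  lies in every subgroup that contains all squares. The stabiliser of a square root \<open>i\<close> of \<open>-1\<close> is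
  such a subgroup of the Galois group, since each automorphism sends \<open>i\<close> to \<open>i\<close> or \<open>-i\<close>. It is
  proper: as \<open>K\<close> has odd degree, \<open>i\<close> is not in \<open>K\<close>, and the conjugation of \<open>K(i)\<close> over \<open>K\<close> extends
  to the algebraic closure by Zorn's lemma.
\<close>


section \<open>Ring graphs\<close>

text \<open>
  Partial ring homomorphisms are represented by their graphs. Injectivity need not be required:
  a nonzero algebraic element divides a nonzero rational number.
\<close>

definition ring_graph :: "('a::field_char_0 \<times> 'a) set \<Rightarrow> bool" where
  "ring_graph \<Gamma> \<longleftrightarrow>
     (\<forall>q\<in>\<rat>. (q, q) \<in> \<Gamma>) \<and>
     (\<forall>x y x' y'. (x, y) \<in> \<Gamma> \<longrightarrow> (x', y') \<in> \<Gamma> \<longrightarrow> (x + x', y + y') \<in> \<Gamma> \<and> (x * x', y * y') \<in> \<Gamma>) \<and>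
     (\<forall>y. (0, y) \<in> \<Gamma> \<longrightarrow> y = 0)"

text \<open>The graph of the map that the partial homomorphism induces on polynomials by acting on
  each coefficient.\<close>

definition graph_polys :: "('a::field_char_0 \<times> 'a) set \<Rightarrow> ('a poly \<times> 'a poly) set" where
  "graph_polys \<Gamma> = {(f, g). \<forall>n. (coeff f n, coeff g n) \<in> \<Gamma>}"

text \<open>The extension f(a) -> g(b) to the ring generated by \<open>a\<close> over the domain. As
  a set of pairs it exists for every \<open>b\<close>; whether it is well defined is settled in
  \<open>ring_graph_adjoin\<close>.\<close>

definition adjoin :: "('a::field_char_0 \<times> 'a) set \<Rightarrow> 'a \<Rightarrow> 'a \<Rightarrow> ('a \<times> 'a) set" where
  "adjoin \<Gamma> a b = (\<lambda>(f, g). (poly f a, poly g b)) ` graph_polys \<Gamma>"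

lemma ring_graphI:
  assumes "\<And>q. q \<in> \<rat> \<Longrightarrow> (q, q) \<in> \<Gamma>"
    and "\<And>x y x' y'. (x, y) \<in> \<Gamma> \<Longrightarrow> (x', y') \<in> \<Gamma> \<Longrightarrow> (x + x', y + y') \<in> \<Gamma>"
    and "\<And>x y x' y'. (x, y) \<in> \<Gamma> \<Longrightarrow> (x', y') \<in> \<Gamma> \<Longrightarrow> (x * x', y * y') \<in> \<Gamma>"
    and "\<And>y. (0, y) \<in> \<Gamma> \<Longrightarrow> y = 0"
  shows "ring_graph \<Gamma>"
  unfolding ring_graph_def by (intro conjI ballI allI impI assms)

context
  fixes \<Gamma> :: "('a::field_char_0 \<times> 'a) set"
  assumes \<Gamma>: "ring_graph \<Gamma>"
begin

section \<open>Arithmetic inside a ring graph\<close>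

lemma graph_rat: "q \<in> \<rat> \<Longrightarrow> (q, q) \<in> \<Gamma>"
  and graph_add: "(x, y) \<in> \<Gamma> \<Longrightarrow> (x', y') \<in> \<Gamma> \<Longrightarrow> (x + x', y + y') \<in> \<Gamma>"
  and graph_mult: "(x, y) \<in> \<Gamma> \<Longrightarrow> (x', y') \<in> \<Gamma> \<Longrightarrow> (x * x', y * y') \<in> \<Gamma>"
  and graph_zero: "(0, y) \<in> \<Gamma> \<Longrightarrow> y = 0"
  using \<Gamma> unfolding ring_graph_def by simp_all

lemma graph_minus: "(x, y) \<in> \<Gamma> \<Longrightarrow> (x', y') \<in> \<Gamma> \<Longrightarrow> (x - x', y - y') \<in> \<Gamma>"
  using graph_add[of x y "- 1 * x'" "- 1 * y'"] graph_mult[of "- 1" "- 1" x' y'] graph_rat[of "- 1"]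
  by simp

text \<open>Differences stay in the graph, so single-valuedness everywhere reduces to the fibre over
  0.\<close>

lemma graph_unique: "(x, y) \<in> \<Gamma> \<Longrightarrow> (x, y') \<in> \<Gamma> \<Longrightarrow> y = y'"
  using graph_minus[of x y x y'] graph_zero[of "y - y'"] by auto

lemma graph_sum: "(\<And>i. i \<in> A \<Longrightarrow> (f i, g i) \<in> \<Gamma>) \<Longrightarrow> (sum f A, sum g A) \<in> \<Gamma>"
  by (induction A rule: infinite_finite_induct) (auto intro: graph_rat graph_add)

lemma graph_power: "(x, y) \<in> \<Gamma> \<Longrightarrow> (x ^ n, y ^ n) \<in> \<Gamma>"
  by (induction n) (auto intro: graph_rat graph_mult)

lemma graph_poly_rat: "(\<And>n. coeff p n \<in> \<rat>) \<Longrightarrow> (x, y) \<in> \<Gamma> \<Longrightarrow> (poly p x, poly p y) \<in> \<Gamma>"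
  unfolding poly_altdef by (intro graph_sum graph_mult graph_rat graph_power)

section \<open>Polynomials matched coefficient by coefficient\<close>

lemma graph_polys_rat: "(\<And>n. coeff p n \<in> \<rat>) \<Longrightarrow> (p, p) \<in> graph_polys \<Gamma>"
  by (simp add: graph_polys_def graph_rat)

lemma graph_polys_const: "(x, y) \<in> \<Gamma> \<Longrightarrow> ([:x:], [:y:]) \<in> graph_polys \<Gamma>"
  by (auto simp: graph_polys_def coeff_pCons graph_rat split: nat.splits)

lemma graph_polys_monom: "(x, y) \<in> \<Gamma> \<Longrightarrow> (monom x n, monom y n) \<in> graph_polys \<Gamma>"
  by (auto simp: graph_polys_def graph_rat)

lemma graph_polys_add:
  "(f, g) \<in> graph_polys \<Gamma> \<Longrightarrow> (f', g') \<in> graph_polys \<Gamma> \<Longrightarrow> (f + f', g + g') \<in> graph_polys \<Gamma>"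
  by (simp add: graph_polys_def graph_add)

lemma graph_polys_minus:
  "(f, g) \<in> graph_polys \<Gamma> \<Longrightarrow> (f', g') \<in> graph_polys \<Gamma> \<Longrightarrow> (f - f', g - g') \<in> graph_polys \<Gamma>"
  by (simp add: graph_polys_def graph_minus)

lemma graph_polys_mult:
  "(f, g) \<in> graph_polys \<Gamma> \<Longrightarrow> (f', g') \<in> graph_polys \<Gamma> \<Longrightarrow> (f * f', g * g') \<in> graph_polys \<Gamma>"
  by (auto simp: graph_polys_def coeff_mult intro!: graph_sum graph_mult)

lemma graph_polys_smult:
  "(x, y) \<in> \<Gamma> \<Longrightarrow> (f, g) \<in> graph_polys \<Gamma> \<Longrightarrow> (smult x f, smult y g) \<in> graph_polys \<Gamma>"
  by (simp add: graph_polys_def graph_mult)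

section \<open>Adjoining one element to the domain\<close>

lemma adjoin_extends: "\<Gamma> \<subseteq> adjoin \<Gamma> a b"
proof safe
  fix x y
  assume "(x, y) \<in> \<Gamma>"
  then show "(x, y) \<in> adjoin \<Gamma> a b"
    unfolding adjoin_def using graph_polys_const by (intro rev_image_eqI) auto
qed

lemma adjoin_generator: "(a, b) \<in> adjoin \<Gamma> a b"
proof -
  have "(monom 1 1, monom 1 1) \<in> graph_polys \<Gamma>"
    by (intro graph_polys_monom graph_rat) simp
  then show ?thesis
    unfolding adjoin_def by (rule rev_image_eqI) (simp add: poly_monom)
qed

text \<open>Closure under the operations is automatic; the assumption supplies exactly the fibre
  over 0.\<close>

lemma ring_graph_adjoin:
  assumes "\<And>f g. (f, g) \<in> graph_polys \<Gamma> \<Longrightarrow> poly f a = 0 \<Longrightarrow> poly g b = 0"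
  shows "ring_graph (adjoin \<Gamma> a b)"
proof (rule ring_graphI)
  show "(q, q) \<in> adjoin \<Gamma> a b" if "q \<in> \<rat>" for q
    using graph_rat[OF that] adjoin_extends by blast
next
  fix x y x' y'
  assume "(x, y) \<in> adjoin \<Gamma> a b" "(x', y') \<in> adjoin \<Gamma> a b"
  then obtain f g f' g' where *: "(f, g) \<in> graph_polys \<Gamma>" "(f', g') \<in> graph_polys \<Gamma>"
      "x = poly f a" "y = poly g b" "x' = poly f' a" "y' = poly g' b"
    unfolding adjoin_def by auto
  show "(x + x', y + y') \<in> adjoin \<Gamma> a b"
    unfolding adjoin_def using graph_polys_add[OF *(1,2)] by (rule rev_image_eqI) (simp add: *)
  show "(x * x', y * y') \<in> adjoin \<Gamma> a b"
    unfolding adjoin_def using graph_polys_mult[OF *(1,2)] by (rule rev_image_eqI) (simp add: *)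
next
  show "y = 0" if "(0, y) \<in> adjoin \<Gamma> a b" for y
    using that assms unfolding adjoin_def by auto
qed

text \<open>Since \<open>x\<close> is sent to 0, the value p(x) = 0 is sent to p(0), so the constant
  term vanishes. Then x times a shorter polynomial at x is 0, and induction applies unless x =
  0.\<close>

lemma graph_nonzero:
  assumes p: "p \<noteq> 0" "\<And>n. coeff p n \<in> \<rat>" "poly p x = 0" and "(x, 0) \<in> \<Gamma>"
  shows "x = 0"
  using p
proof (induction p rule: pCons_induct)
  case (pCons c p)
  have rat: "c \<in> \<rat>" "coeff p n \<in> \<rat>" for n
    using pCons.prems(2)[of 0] pCons.prems(2)[of "Suc n"] by auto
  have "(poly (pCons c p) x, poly (pCons c p) 0) \<in> \<Gamma>"
    by (intro graph_poly_rat) (use pCons.prems assms in auto)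
  then have "c = 0"
    using pCons.prems graph_zero by (simp del: poly_pCons) simp
  then show ?case
    using pCons rat by auto
qed simp

text \<open>Pseudo-division by a polynomial of least degree annihilating \<open>a\<close>.\<close>

lemma annihilator_transfer:
  assumes inj: "\<And>x. (x, 0) \<in> \<Gamma> \<Longrightarrow> x = 0"
    and p: "(p, q) \<in> graph_polys \<Gamma>" "p \<noteq> 0" "poly p a = 0" "poly q b = 0"
    and least: "\<And>f g. (f, g) \<in> graph_polys \<Gamma> \<Longrightarrow> f \<noteq> 0 \<Longrightarrow> poly f a = 0 \<Longrightarrow>
                  Polynomial.degree p \<le> Polynomial.degree f"
    and "(f, g) \<in> graph_polys \<Gamma>" "poly f a = 0"
  shows "poly g b = 0"
  using assms(7,8)
proof (induction "Polynomial.degree f" arbitrary: f g rule: less_induct)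
  case less
  have coeffs: "(coeff f n, coeff g n) \<in> \<Gamma>" "(coeff p n, coeff q n) \<in> \<Gamma>" for n
    using less.prems p(1) by (auto simp: graph_polys_def)
  \<comment> \<open>Single-valuedness at 0 forces the partner of the zero polynomial to vanish. This
    covers both f = 0 and a zero pseudo-remainder.\<close>
  have zero: "poly g' b = 0" if "(0, g') \<in> graph_polys \<Gamma>" for g'
  proof -
    have "g' = 0"
      using that by (intro poly_eqI) (simp add: graph_polys_def graph_zero)
    then show ?thesis
      by simp
  qed
  define d m where "d = Polynomial.degree p" and "m = Polynomial.degree f"
  \<comment> \<open>The domain is only known to be a ring, so the leading coefficient of
    \<open>p\<close> is multiplied onto \<open>f\<close> rather than inverted. The same operation on
    the partners keeps the pair matched.\<close>
  define f' where "f' = smult (coeff p d) f - monom (coeff f m) (m - d) * p"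
  define g' where "g' = smult (coeff q d) g - monom (coeff g m) (m - d) * q"
  show ?case
  proof (cases "f = 0")
    case False
    then have "d \<le> m"
      using least less.prems by (auto simp: d_def m_def)
    have fg': "(f', g') \<in> graph_polys \<Gamma>"
      unfolding f'_def g'_def
      by (intro graph_polys_minus graph_polys_smult graph_polys_mult graph_polys_monom coeffs
          less.prems p)
    have "poly f' a = 0"
      by (simp add: f'_def less.prems p)
    have "Polynomial.degree f' \<le> m"
      using \<open>d \<le> m\<close> unfolding f'_def
      by (intro degree_diff_le order.trans[OF degree_smult_le] order.trans[OF degree_mult_le])
         (use degree_monom_le[of "coeff f m" "m - d"] in \<open>auto simp: d_def m_def\<close>)
    moreover have "coeff f' m = 0"
      using \<open>d \<le> m\<close> by (simp add: f'_def coeff_monom_mult)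
    ultimately have "f' = 0 \<or> Polynomial.degree f' < m"
      by (metis eq_zero_or_degree_less)
    then have "poly g' b = 0"
      using zero less.hyps[of f' g'] fg' \<open>poly f' a = 0\<close> by (auto simp: m_def)
    then have "coeff q d * poly g b = 0"
      by (simp add: g'_def p)
    \<comment> \<open>Injectivity keeps the partner of the leading coefficient of \<open>p\<close>
      nonzero, so it can be cancelled.\<close>
    moreover have "coeff q d \<noteq> 0"
      using inj[of "coeff p d"] coeffs(2)[of d] p(2) by (force simp: d_def)
    ultimately show ?thesis
      by simp
  qed (use zero less.prems in auto)
qed

end



section \<open>Extending partial homomorphisms\<close>

lemma ring_graph_injective:
  assumes "ring_graph \<Gamma>" "\<And>x::'a::field_char_0. algebraic x" "(x::'a, 0) \<in> \<Gamma>"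
  shows "x = 0"
proof -
  obtain p where "p \<noteq> 0" "\<And>n. coeff p n \<in> \<rat>" "poly p x = 0"
    using assms(2)[of x] by (auto simp: algebraic_altdef)
  then show ?thesis
    using graph_nonzero[OF assms(1) _ _ _ assms(3)] by blast
qed

text \<open>Take \<open>p\<close> of least degree among the nonzero annihilators of \<open>a\<close>
  with coefficients in the domain. Any root \<open>b\<close> of its partner \<open>q\<close> is an
  admissible image of \<open>a\<close>, by \<open>annihilator_transfer\<close>.\<close>

lemma exists_ring_graph_adjoin:
  fixes \<Gamma> :: "('a::field_char_0 \<times> 'a) set"
  assumes \<Gamma>: "ring_graph \<Gamma>"
    and alg: "\<And>x::'a. algebraic x"
    and closed: "\<And>p::'a poly. Polynomial.degree p > 0 \<Longrightarrow> \<exists>x. poly p x = 0"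
  shows "\<exists>b. ring_graph (adjoin \<Gamma> a b)"
proof -
  note inj = ring_graph_injective[OF \<Gamma> alg]
  define A where "A = {(f, g). (f, g) \<in> graph_polys \<Gamma> \<and> f \<noteq> 0 \<and> poly f a = 0}"
  obtain r where "r \<noteq> 0" "\<And>n. coeff r n \<in> \<rat>" "poly r a = 0"
    using alg[of a] by (auto simp: algebraic_altdef)
  \<comment> \<open>A rational annihilator is its own partner, so there is something to minimise
    over.\<close>
  then have "(r, r) \<in> A"
    by (simp add: A_def graph_polys_rat[OF \<Gamma>])
  define P where "P = arg_min (\<lambda>(f, g). Polynomial.degree f) (\<lambda>P. P \<in> A)"
  obtain p q where pq: "P = (p, q)"
    by (cases P)
  have "(p, q) \<in> A"
    using arg_min_natI[where P = "\<lambda>P. P \<in> A", OF \<open>(r, r) \<in> A\<close>] by (metis P_def pq)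
  have least: "Polynomial.degree p \<le> Polynomial.degree f" if "(f, g) \<in> A" for f g
    using arg_min_nat_le[of "\<lambda>P. P \<in> A", OF that, of "\<lambda>(f, g). Polynomial.degree f"] pq
    by (simp add: P_def)
  have p: "(p, q) \<in> graph_polys \<Gamma>" "p \<noteq> 0" "poly p a = 0"
    using \<open>(p, q) \<in> A\<close> by (auto simp: A_def)
  have "Polynomial.degree p > 0"
    using p by (metis degree_eq_zeroE gr0I pCons_0_0 poly_const_conv)
  moreover have "(coeff p (Polynomial.degree p), coeff q (Polynomial.degree p)) \<in> \<Gamma>"
    using p by (simp add: graph_polys_def)
  then have "coeff q (Polynomial.degree p) \<noteq> 0"
    using inj[of "coeff p (Polynomial.degree p)"] p(2) by force
  \<comment> \<open>\<open>q\<close> has a nonzero coefficient at the positive index given by the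
    degree of \<open>p\<close>; hence it is not constant and has a root.\<close>
  ultimately have "Polynomial.degree q > 0"
    using le_degree order.strict_trans2 by blast
  then obtain b where b: "poly q b = 0"
    using closed by blast
  have least': "Polynomial.degree p \<le> Polynomial.degree f"
    if "(f, g) \<in> graph_polys \<Gamma>" "f \<noteq> 0" "poly f a = 0" for f g
    using least that by (auto simp: A_def)
  have "poly g b = 0" if "(f, g) \<in> graph_polys \<Gamma>" "poly f a = 0" for f g
    using annihilator_transfer[OF \<Gamma> inj p b least' that] .
  then show ?thesis
    using ring_graph_adjoin[OF \<Gamma>] by blast
qed

text \<open>Each closure condition involves at most two pairs, and two pairs of the union lie in a
  common member of the chain.\<close>

lemma ring_graph_Union_chain:
  assumes "C \<noteq> {}" "subset.chain {\<Gamma>. ring_graph \<Gamma>} C"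
  shows "ring_graph (\<Union> C)"
proof -
  have graphs: "ring_graph \<Gamma>" if "\<Gamma> \<in> C" for \<Gamma>
    using assms that by (auto simp: subset.chain_def)
  have common: "\<exists>\<Gamma>\<in>C. u \<in> \<Gamma> \<and> v \<in> \<Gamma>" if "u \<in> \<Union> C" "v \<in> \<Union> C" for u v
    using assms(2) that unfolding subset_chain_def by blast
  show ?thesis
  proof (rule ring_graphI)
    show "(q, q) \<in> \<Union> C" if "q \<in> \<rat>" for q
      using assms(1) graph_rat[OF graphs that] by blast
    show "y = 0" if "(0, y) \<in> \<Union> C" for y
      using that graph_zero[OF graphs] by blast
  next
    fix x y x' y'
    assume "(x, y) \<in> \<Union> C" "(x', y') \<in> \<Union> C"
    then obtain \<Gamma> where "\<Gamma> \<in> C" "(x, y) \<in> \<Gamma>" "(x', y') \<in> \<Gamma>"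
      using common by blast
    then show "(x + x', y + y') \<in> \<Union> C" "(x * x', y * y') \<in> \<Union> C"
      using graph_add[OF graphs] graph_mult[OF graphs] by blast+
  qed
qed

text \<open>A maximal extension, given by Zorn's lemma, is total: adjoining any \<open>a\<close>
  cannot enlarge it, so \<open>a\<close> is already in its domain.\<close>

lemma ring_graph_total_extension:
  fixes \<Gamma> :: "('a::field_char_0 \<times> 'a) set"
  assumes \<Gamma>: "ring_graph \<Gamma>"
    and alg: "\<And>x::'a. algebraic x"
    and closed: "\<And>p::'a poly. Polynomial.degree p > 0 \<Longrightarrow> \<exists>x. poly p x = 0"
  obtains \<Delta> where "ring_graph \<Delta>" "\<Gamma> \<subseteq> \<Delta>" "Domain \<Delta> = UNIV"
proof -
  let ?A = "{\<Delta>. ring_graph \<Delta> \<and> \<Gamma> \<subseteq> \<Delta>}"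
  have "\<exists>\<Delta>\<in>?A. \<forall>\<Theta>\<in>?A. \<Delta> \<subseteq> \<Theta> \<longrightarrow> \<Theta> = \<Delta>"
  proof (rule subset_Zorn_nonempty)
    show "?A \<noteq> {}"
      using \<Gamma> by auto
    fix C assume C: "C \<noteq> {}" "subset.chain ?A C"
    then have "subset.chain {\<Gamma>. ring_graph \<Gamma>} C"
      by (auto simp: subset_chain_def)
    then have "ring_graph (\<Union> C)"
      using C(1) by (intro ring_graph_Union_chain)
    moreover obtain \<Theta> where "\<Theta> \<in> C" "\<Gamma> \<subseteq> \<Theta>"
      using C unfolding subset_chain_def by fast
    then have "\<Gamma> \<subseteq> \<Union> C"
      by fast
    ultimately show "\<Union> C \<in> ?A"
      by simp
  qed
  then obtain \<Delta> where \<Delta>: "ring_graph \<Delta>" "\<Gamma> \<subseteq> \<Delta>"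
    and maximal: "\<forall>\<Theta>\<in>?A. \<Delta> \<subseteq> \<Theta> \<longrightarrow> \<Theta> = \<Delta>"
    by auto
  have "a \<in> Domain \<Delta>" for a
  proof -
    obtain b where b: "ring_graph (adjoin \<Delta> a b)"
      using exists_ring_graph_adjoin[OF \<Delta>(1) alg closed] by blast
    have "\<Delta> \<subseteq> adjoin \<Delta> a b"
      by (rule adjoin_extends[OF \<Delta>(1)])
    with b \<Delta>(2) maximal have "adjoin \<Delta> a b = \<Delta>"
      by simp
    then show ?thesis
      using adjoin_generator[OF \<Delta>(1), of a b] by auto
  qed
  then have "Domain \<Delta> = UNIV"
    by auto
  with \<Delta> show ?thesis
    by (rule that)
qed

lemma ring_graph_automorphism:
  fixes \<Gamma> :: "('a::field_char_0 \<times> 'a) set"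
  assumes \<Gamma>: "ring_graph \<Gamma>"
    and alg: "\<And>x::'a. algebraic x"
    and closed: "\<And>p::'a poly. Polynomial.degree p > 0 \<Longrightarrow> \<exists>x. poly p x = 0"
  obtains \<sigma> :: "'a \<Rightarrow> 'a" where "bij \<sigma>" "\<And>x y. \<sigma> (x + y) = \<sigma> x + \<sigma> y"
    "\<And>x y. \<sigma> (x * y) = \<sigma> x * \<sigma> y" "\<And>x y. (x, y) \<in> \<Gamma> \<Longrightarrow> \<sigma> x = y"
proof -
  obtain \<Delta> where \<Delta>: "ring_graph \<Delta>" "\<Gamma> \<subseteq> \<Delta>" "Domain \<Delta> = UNIV"
    using ring_graph_total_extension[OF \<Gamma> alg closed] .
  then have "\<forall>x. \<exists>y. (x, y) \<in> \<Delta>"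
    by auto
  then obtain \<sigma> where \<sigma>: "\<And>x. (x, \<sigma> x) \<in> \<Delta>"
    by metis
  have eq: "\<sigma> x = y" if "(x, y) \<in> \<Delta>" for x y
    using graph_unique[OF \<Delta>(1) \<sigma> that] .
  have "inj \<sigma>"
  proof (rule injI)
    fix x y assume "\<sigma> x = \<sigma> y"
    then have "(x - y, 0) \<in> \<Delta>"
      using graph_minus[OF \<Delta>(1) \<sigma>[of x] \<sigma>[of y]] by simp
    then show "x = y"
      using ring_graph_injective[OF \<Delta>(1) alg] by force
  qed
  moreover have "y \<in> range \<sigma>" for y
  proof -
    \<comment> \<open>Surjectivity: \<sigma> maps the finite root set of a rational polynomial into
      itself and is injective, so it permutes the roots, among them \<open>y\<close>.\<close>
    obtain p where p: "p \<noteq> 0" "\<And>n. coeff p n \<in> \<rat>" "poly p y = 0"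
      using alg[of y] by (auto simp: algebraic_altdef)
    let ?R = "{z. poly p z = 0}"
    have "finite ?R"
      using p(1) by (rule poly_roots_finite)
    moreover have "\<sigma> ` ?R \<subseteq> ?R"
    proof safe
      fix z assume "poly p z = 0"
      then have "(0, poly p (\<sigma> z)) \<in> \<Delta>"
        using graph_poly_rat[OF \<Delta>(1) p(2) \<sigma>, of z] by simp
      then show "poly p (\<sigma> z) = 0"
        by (rule graph_zero[OF \<Delta>(1)])
    qed
    ultimately have "\<sigma> ` ?R = ?R"
      using \<open>inj \<sigma>\<close> by (meson endo_inj_surj inj_on_subset subset_UNIV)
    then show ?thesis
      using p(3) by blast
  qed
  ultimately have "bij \<sigma>"
    by (auto simp: bij_def)
  moreover have "\<sigma> (x + y) = \<sigma> x + \<sigma> y" "\<sigma> (x * y) = \<sigma> x * \<sigma> y" for x y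
    using graph_add[OF \<Delta>(1) \<sigma> \<sigma>] graph_mult[OF \<Delta>(1) \<sigma> \<sigma>] eq by blast+
  ultimately show thesis
    using that eq \<Delta>(2) by blast
qed


section \<open>Automorphisms moving a square root of \<open>-1\<close>\<close>

text \<open>As \<open>i\<close> is not in \<open>K\<close>, the polynomial X^2 + 1 has least degree
  among the annihilators of \<open>i\<close> over \<open>K\<close>. Its other root
  \<open>- i\<close> is therefore an admissible image of \<open>i\<close> over the identity of
  \<open>K\<close>.\<close>

lemma conjugation_extends:
  fixes K :: "'a::field_char_0 set" and i :: 'a
  assumes K: "\<rat> \<subseteq> K" "\<And>x y. x \<in> K \<Longrightarrow> y \<in> K \<Longrightarrow> x + y \<in> K"
      "\<And>x y. x \<in> K \<Longrightarrow> y \<in> K \<Longrightarrow> x * y \<in> K" "\<And>x. x \<in> K \<Longrightarrow> inverse x \<in> K"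
    and i: "i * i = -1" "i \<notin> K"
    and alg: "\<And>x::'a. algebraic x"
    and closed: "\<And>p::'a poly. Polynomial.degree p > 0 \<Longrightarrow> \<exists>x. poly p x = 0"
  obtains \<sigma> :: "'a \<Rightarrow> 'a" where "bij \<sigma>" "\<And>x y. \<sigma> (x + y) = \<sigma> x + \<sigma> y"
    "\<And>x y. \<sigma> (x * y) = \<sigma> x * \<sigma> y" "\<And>x. x \<in> K \<Longrightarrow> \<sigma> x = x" "\<sigma> i = - i"
proof -
  have graph: "ring_graph (Id_on K)"
    using K by (intro ring_graphI) auto
  let ?p = "[:1, 0, 1:] :: 'a poly"
  have p: "(?p, ?p) \<in> graph_polys (Id_on K)" "?p \<noteq> 0" "poly ?p i = 0" "poly ?p (- i) = 0"
    using i K(1) by (auto simp: graph_polys_def coeff_pCons split: nat.splits)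
  have least: "Polynomial.degree ?p \<le> Polynomial.degree f"
    if "(f, g) \<in> graph_polys (Id_on K)" "f \<noteq> 0" "poly f i = 0" for f g
  proof (rule ccontr)
    assume "\<not> ?thesis"
    then have deg: "Polynomial.degree f \<le> 1"
      by simp
    have coeffs: "coeff f n \<in> K" for n
      using that(1) by (auto simp: graph_polys_def Id_on_def)
    have "f = [:coeff f 0, coeff f 1:]"
      using deg by (intro poly_eqI) (auto simp: coeff_pCons coeff_eq_0 split: nat.splits)
    then obtain u v where f: "f = [:u, v:]"
      by blast
    have uv: "u \<in> K" "v \<in> K" "u = - (i * v)"
      using coeffs[of 0] coeffs[of 1] that(3) by (auto simp: f eq_neg_iff_add_eq_0)
    with that(2) have "v \<noteq> 0"
      by (auto simp: f)
    \<comment> \<open>A nonzero annihilator u + vX would put i = -u/v into \<open>K\<close>.\<close>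
    then have "i = (- 1) * (u * inverse v)"
      by (simp add: uv(3))
    also have "\<dots> \<in> K"
      using K(1) by (intro K uv) auto
    finally show False
      using i(2) by contradiction
  qed
  have inj: "x = 0" if "(x, 0) \<in> Id_on K" for x
    using that by auto
  have "ring_graph (adjoin (Id_on K) i (- i))"
    using annihilator_transfer[OF graph inj p least] by (rule ring_graph_adjoin[OF graph])
  then obtain \<sigma> :: "'a \<Rightarrow> 'a" where "bij \<sigma>" "\<And>x y. \<sigma> (x + y) = \<sigma> x + \<sigma> y"
    "\<And>x y. \<sigma> (x * y) = \<sigma> x * \<sigma> y" "\<And>x y. (x, y) \<in> adjoin (Id_on K) i (- i) \<Longrightarrow> \<sigma> x = y"
    using ring_graph_automorphism[OF _ alg closed] by metis
  with that show ?thesis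
    using adjoin_extends[OF graph] adjoin_generator[OF graph] by (meson Id_onI subsetD)
qed


section \<open>Words in squares\<close>

text \<open>The parameters \<open>a\<close> and \<open>k\<close> are free so that both words of the
  theorem are instances.\<close>

lemma (in group) word_map_in_subgroup:
  fixes a \<delta> k :: int
  assumes N: "subgroup N G" and squares: "\<And>x. x \<in> carrier G \<Longrightarrow> x \<otimes> x \<in> N"
    and xy: "x \<in> carrier G" "y \<in> carrier G"
    and w: "w = x1 [^]\<^bsub>F2\<^esub> (2 * a) \<otimes>\<^bsub>F2\<^esub> y_word \<delta> k"
  shows "word_map G w (x, y) \<in> N"
proof -
  interpret F: group F2
    by (rule group_free_group)
  interpret N: subgroup N G
    by (rule N)
  let ?f = "case_gen2 x y"
  have f: "range ?f \<subseteq> carrier G"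
    using xy by (auto split: gen2.splits)
  interpret h: group_hom F2 G "subst_word G ?f"
    by unfold_locales (rule subst_word_hom[OF f])
  have gens: "subst_word G ?f x1 = x" "subst_word G ?f x2 = y"
    using subst_word_free_gen[OF f] by simp_all
  note closed = free_gen_closed F.m_closed F.int_pow_closed F.inv_closed
  have even: "z [^] (2 * c) \<in> N" if "z \<in> carrier G" for z and c :: int
  proof -
    have "z [^] (2 * c) = z [^] c \<otimes> z [^] c"
      using that by (simp add: int_pow_mult[symmetric])
    then show ?thesis
      using squares that by simp
  qed
  have l_cancel_inv: "u \<otimes> (inv u \<otimes> v) = v" if "u \<in> carrier G" "v \<in> carrier G" for u v
    using that by (simp add: m_assoc[symmetric])
  text \<open>A subgroup containing all squares is normal, as \<open>y n y\<inverse> = (y n)\<^sup>2 n\<inverse> y\<inverse>\<^sup>2\<close>.\<close>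
  have conj: "y \<otimes> n \<otimes> inv y \<in> N" if "n \<in> N" for n
  proof -
    have n: "n \<in> carrier G"
      using that by (rule N.mem_carrier)
    have "y \<otimes> n \<otimes> inv y = (y \<otimes> n) \<otimes> (y \<otimes> n) \<otimes> inv n \<otimes> (inv y \<otimes> inv y)"
      using n xy by (simp add: m_assoc l_cancel_inv)
    then show ?thesis
      using squares n xy that by (auto intro!: N.m_closed)
  qed
  \<comment> \<open>Regroup the base of \<open>y_word\<close> as an even power times a conjugate of
    an even power.\<close>
  have "x [^] (2::int) \<otimes> y \<otimes> x [^] (2 * \<delta>) \<otimes> inv y = x [^] (2 * 1 :: int) \<otimes> (y \<otimes> x [^] (2 * \<delta>) \<otimes> inv y)"
    using xy by (simp add: m_assoc)
  also have "\<dots> \<in> N"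
    using xy by (intro N.m_closed conj even)
  finally have y1: "x [^] (2::int) \<otimes> y \<otimes> x [^] (2 * \<delta>) \<otimes> inv y \<in> N" .
  \<comment> \<open>Substitution is a homomorphism from the free group, so the word can be evaluated
    factor by factor.\<close>
  have "word_map G w (x, y) =
      x [^] (2 * a) \<otimes> (x [^] (2::int) \<otimes> y \<otimes> x [^] (2 * \<delta>) \<otimes> inv y) [^] k"
    unfolding word_map_def w y_word_def prod.case
    by (simp only: h.hom_mult h.hom_int_pow h.hom_inv closed gens)
  also have "\<dots> \<in> N"
    using xy(1) y1 by (intro N.m_closed[OF even subgroup_int_pow_closed[OF N]])
  finally show ?thesis .
qed


section \<open>The ring structure of a field type\<close>

lemma ring_of_type_algebra_simps [simp]:
  "carrier ring_of_type_algebra = UNIV"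
  "x \<otimes>\<^bsub>ring_of_type_algebra\<^esub> y = x * y"
  "x \<oplus>\<^bsub>ring_of_type_algebra\<^esub> y = x + y"
  "\<one>\<^bsub>ring_of_type_algebra\<^esub> = 1"
  "\<zero>\<^bsub>ring_of_type_algebra\<^esub> = 0"
  by (simp_all add: ring_of_type_algebra_def)

lemma ring_of_type_algebra_a_inv [simp]:
  "\<ominus>\<^bsub>ring_of_type_algebra\<^esub> x = - (x::'a::field)"
proof -
  interpret field "ring_of_type_algebra :: 'a ring"
    by (rule field_from_type_algebra)
  show ?thesis
    by (rule minus_equality) simp_all
qed

lemma ring_of_type_algebra_m_inv [simp]:
  "x \<noteq> 0 \<Longrightarrow> inv\<^bsub>ring_of_type_algebra\<^esub> x = inverse (x::'a::field)"
proof -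
  interpret field "ring_of_type_algebra :: 'a ring"
    by (rule field_from_type_algebra)
  show "inv\<^bsub>ring_of_type_algebra\<^esub> x = inverse x" if "x \<noteq> 0"
    using that by (intro inv_char) simp_all
qed

lemma ring_of_type_algebra_nat_pow [simp]:
  "x [^]\<^bsub>ring_of_type_algebra\<^esub> (n::nat) = (x::'a::field) ^ n"
  by (induction n) (simp_all add: mult.commute)

text \<open>\<open>ring.eval\<close> reads coefficient lists from the leading term down,
  \<open>Poly\<close> from the constant term up; hence the reversal.\<close>

lemma ring_of_type_algebra_eval:
  "ring.eval ring_of_type_algebra xs x = poly (Poly (rev xs)) (x::'a::field)"
proof -
  interpret field "ring_of_type_algebra :: 'a ring"
    by (rule field_from_type_algebra)
  show ?thesis
    by (induction xs) (simp_all add: Poly_append poly_monom)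
qed

lemma subfield_type_closed:
  fixes K :: "'a::field set"
  assumes "subfield K ring_of_type_algebra"
  shows "0 \<in> K" "1 \<in> K" "x \<in> K \<Longrightarrow> y \<in> K \<Longrightarrow> x + y \<in> K" "x \<in> K \<Longrightarrow> y \<in> K \<Longrightarrow> x * y \<in> K"
    "x \<in> K \<Longrightarrow> inverse x \<in> K"
proof -
  interpret field "ring_of_type_algebra :: 'a ring"
    by (rule field_from_type_algebra)
  note K = subringE[OF subfieldE(1)[OF assms]]
  show "0 \<in> K" "1 \<in> K" "x \<in> K \<Longrightarrow> y \<in> K \<Longrightarrow> x + y \<in> K" "x \<in> K \<Longrightarrow> y \<in> K \<Longrightarrow> x * y \<in> K"
    using K(2,3,6,7) by simp_all
  \<comment> \<open>At x = 0 the convention inverse 0 = 0 applies.\<close>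
  show "inverse x \<in> K" if "x \<in> K"
    using subfield_m_inv(1)[OF assms, of x] that by (cases "x = 0") auto
qed

lemma subfieldI_type:
  fixes K :: "'a::field set"
  assumes "1 \<in> K" "\<And>x. x \<in> K \<Longrightarrow> - x \<in> K" "\<And>x y. x \<in> K \<Longrightarrow> y \<in> K \<Longrightarrow> x + y \<in> K"
    "\<And>x y. x \<in> K \<Longrightarrow> y \<in> K \<Longrightarrow> x * y \<in> K" "\<And>x. x \<in> K \<Longrightarrow> inverse x \<in> K"
  shows "subfield K ring_of_type_algebra"
proof -
  interpret field "ring_of_type_algebra :: 'a ring"
    by (rule field_from_type_algebra)
  show ?thesis
    using assms by (intro subfieldI' subringI) auto
qed

section \<open>Algebraicity and algebraic closedness in terms of type-based polynomials\<close>

lemma algebraic_closure_Rats_algebraic: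
  assumes "algebraic_closure (ring_of_type_algebra :: 'a::field_char_0 ring) \<rat>"
  shows "algebraic (x::'a)"
proof -
  interpret algebraic_closure "ring_of_type_algebra :: 'a ring" \<rat>
    by (rule assms)
  have "subring \<rat> (ring_of_type_algebra :: 'a ring)"
    by (rule subfieldE(1)[OF subfield_axioms])
  moreover have "(ring.algebraic ring_of_type_algebra over \<rat>) x"
    by (rule algebraic_extension) simp
  ultimately obtain xs where xs: "xs \<in> carrier (\<rat>[X]\<^bsub>ring_of_type_algebra\<^esub>)" "xs \<noteq> []"
      "ring.eval ring_of_type_algebra xs x = \<zero>\<^bsub>ring_of_type_algebra\<^esub>"
    using algebraicE[of \<rat> x] by auto
  from xs(1,2) have set: "set xs \<subseteq> \<rat>" and hd: "hd xs \<noteq> 0"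
    by (auto simp: univ_poly_carrier[symmetric] polynomial_def)
  have coeffs: "poly.coeff (Poly (rev xs)) n \<in> \<rat>" for n
    using set nth_mem[of n "rev xs"] by (auto simp: nth_default_def)
  \<comment> \<open>The head of the list becomes the top coefficient; it is nonzero by the normal
    form of list polynomials, so the translated polynomial is nonzero.\<close>
  have "poly.coeff (Poly (rev xs)) (length xs - 1) = hd xs"
    using xs(2) by (simp add: nth_default_def rev_nth hd_conv_nth)
  then have "Poly (rev xs) \<noteq> 0"
    using hd by force
  moreover have "poly (Poly (rev xs)) x = 0"
    using xs(3) by (simp add: ring_of_type_algebra_eval)
  ultimately show ?thesis
    using coeffs unfolding algebraic_altdef by blast
qed

lemma algebraically_closed_type_root:
  fixes p :: "'a::field poly"
  assumes "algebraically_closed (ring_of_type_algebra :: 'a ring)" "Polynomial.degree p > 0"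
  shows "\<exists>x. poly p x = 0"
proof -
  interpret algebraically_closed "ring_of_type_algebra :: 'a ring"
    by (rule assms(1))
  define xs where "xs = rev (coeffs p)"
  have xs: "xs \<in> carrier (poly_ring ring_of_type_algebra)"
    by (auto simp: xs_def univ_poly_carrier[symmetric] polynomial_def hd_rev last_coeffs_eq_coeff_degree)
  moreover have "length xs - 1 = Polynomial.degree p"
    by (simp add: xs_def degree_eq_length_coeffs)
  \<comment> \<open>Over an algebraically closed field the multiset of roots has as many elements as
    the degree, which is positive here.\<close>
  ultimately have "roots xs \<noteq> {#}"
    using roots_over_carrier[of xs] assms(2) by (auto simp: splitted_def)
  then obtain x where "x \<in># roots xs"
    by blast
  then have "ring.eval ring_of_type_algebra xs x = 0"
    using roots_mem_iff_is_root[OF xs] by (simp add: is_root_def)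
  then show ?thesis
    by (auto simp: ring_of_type_algebra_eval xs_def)
qed


section \<open>Number fields of odd degree\<close>

text \<open>Tower law: the field \<rat>(i) lies between \<rat> and \<open>K\<close> and has degree 2
  over \<rat>.\<close>

lemma even_degree_over_Q:
  fixes K :: "'a::field_char_0 set"
  assumes Q: "subfield \<rat> (ring_of_type_algebra :: 'a ring)"
    and K: "number_field K" and i: "i \<in> K" "i * i = -1"
  shows "even (degree_over_Q K)"
proof -
  interpret field "ring_of_type_algebra :: 'a ring"
    by (rule field_from_type_algebra)
  have fin: "finite_dimension \<rat> K" and Kf: "subfield K ring_of_type_algebra"
    using K by (auto simp: number_field_def)
  interpret K: subalgebra \<rat> K "ring_of_type_algebra"
    by (rule finite_dimension_imp_subalgebra[OF Q fin])
  note Kc = subfield_type_closed[OF Kf]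
  have "\<rat> \<subseteq> K"
    using K.smult_closed[OF _ Kc(2)] by auto
  \<comment> \<open>This is \<rat>(i), written as \<rat>i + \<rat> so that its dimension can be read
    off.\<close>
  define F where "F = line_extension \<rat> i \<rat>"
  have F: "z \<in> F \<longleftrightarrow> (\<exists>a\<in>\<rat>. \<exists>b\<in>\<rat>. z = a * i + b)" for z
    by (simp add: F_def line_extension_mem_iff)
  \<comment> \<open>The ambient field carries no order, so the equation is pulled back to the
    rationals, where squares are nonnegative.\<close>
  have nonreal: "i \<noteq> of_rat r" for r
  proof
    assume "i = of_rat r"
    then have "of_rat (r * r) = (of_rat (- 1) :: 'a)"
      using i(2) by (simp add: of_rat_mult)
    then have "r * r = - 1"
      by (simp only: of_rat_eq_iff)
    then show False
      by (metis neg_0_le_iff_le not_one_le_zero zero_le_square)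
  qed
  then have "i \<notin> \<rat>"
    by (metis Rats_cases)
  then have dimF: "dimension 2 \<rat> F"
    using Suc_dim[of i \<rat> 1 \<rat>] dimension_one[OF Q] by (simp add: F_def numeral_2_eq_2)
  have Ff: "subfield F ring_of_type_algebra"
  proof (rule subfieldI_type)
    show "1 \<in> F"
      unfolding F by (intro bexI[of _ 0] bexI[of _ 1]) auto
  next
    fix x y assume "x \<in> F" "y \<in> F"
    then obtain a b c d where *: "a \<in> \<rat>" "b \<in> \<rat>" "c \<in> \<rat>" "d \<in> \<rat>" "x = a * i + b" "y = c * i + d"
      unfolding F by auto
    show "x + y \<in> F"
      unfolding F using * by (intro bexI[of _ "a + c"] bexI[of _ "b + d"]) (auto simp: algebra_simps)
    have "x * y = (a * d + b * c) * i + (a * c * (i * i) + b * d)"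
      by (simp add: * algebra_simps)
    then show "x * y \<in> F"
      unfolding F i(2) using *
      by (intro bexI[of _ "a * d + b * c"] bexI[of _ "a * c * - 1 + b * d"]) auto
  next
    fix x assume "x \<in> F"
    then obtain a b where *: "a \<in> \<rat>" "b \<in> \<rat>" "x = a * i + b"
      unfolding F by auto
    show "- x \<in> F"
      unfolding F using * by (intro bexI[of _ "- a"] bexI[of _ "- b"]) auto
    show "inverse x \<in> F"
    proof (cases "x = 0")
      case True
      then show ?thesis
        unfolding F by (intro bexI[of _ 0]) auto
    next
      case False
      \<comment> \<open>The norm of x = ai + b; multiplying by the conjugate b - ai gives the
        inverse of x.\<close>
      define n where "n = a * a + b * b"
      have "x * (b - a * i) = b * b - a * a * (i * i)"
        by (simp add: * algebra_simps)
      then have n: "x * (b - a * i) = n"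
        by (simp add: i n_def)
      \<comment> \<open>If b = ai with a nonzero, then i = b/a is rational; if a = 0, then b = 0 and
        x = 0.\<close>
      have "b - a * i \<noteq> 0"
      proof
        assume "b - a * i = 0"
        then have "b = a * i"
          by simp
        moreover from this have "a = 0"
          using \<open>i \<notin> \<rat>\<close> *(1,2) Rats_divide[of b a] by (cases "a = 0") auto
        ultimately show False
          using False * by simp
      qed
      with n False have "n \<noteq> 0"
        by auto
      have "inverse x = (- a / n) * i + b / n"
        using n False \<open>n \<noteq> 0\<close> by (simp add: field_simps)
      then show ?thesis
        unfolding F using * by (intro bexI[of _ "- a / n"] bexI[of _ "b / n"]) (auto simp: n_def)
    qed
  qed
  have "F \<subseteq> K"
    using \<open>\<rat> \<subseteq> K\<close> i(1) by (auto simp: F intro!: Kc(3,4))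
  obtain n where "dimension n \<rat> K"
    using fin by (auto simp: finite_dimension_def)
  then obtain Us where Us: "Span \<rat> Us = K"
    using exists_base[OF Q] by blast
  have subK: "subalgebra F K ring_of_type_algebra"
    using \<open>F \<subseteq> K\<close> Kc(4) K.subgroup_axioms
    by (auto simp: subalgebra_def subalgebra_axioms_def)
  have "set Us \<subseteq> K"
    using Span_base_incl[OF Q, of Us] Us by simp
  have "\<rat> \<subseteq> F"
    by (force simp: F)
  \<comment> \<open>A list spanning \<open>K\<close> over \<rat> also spans it over
    \<open>F\<close>. This makes \<open>K\<close> finite-dimensional over \<open>F\<close>, as the
    tower law requires.\<close>
  have "K \<subseteq> Span F Us"
  proof -
    interpret S: subalgebra F "Span F Us" ring_of_type_algebra
      by (rule Span_is_subalgebra[OF Ff]) simp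
    have "subalgebra \<rat> (Span F Us) ring_of_type_algebra"
      using S.subgroup_axioms S.smult_closed \<open>\<rat> \<subseteq> F\<close>
      by (auto simp: subalgebra_def subalgebra_axioms_def simp del: Span.simps)
    then have "Span \<rat> Us \<subseteq> Span F Us"
      using subalgebra_Span_incl[OF Q] Span_base_incl[OF Ff, of Us] by simp
    then show ?thesis
      by (simp only: Us)
  qed
  then have "finite_dimension F K"
    using subalbegra_incl_imp_finite_dimension[OF Ff Span_finite_dimension[OF Ff, of Us] subK] by simp
  then have "dim \<rat> K = dim \<rat> F * dim F K"
    using telescopic_base_dim(2)[OF Q Ff finite_dimensionI[OF dimF]] by (simp add: over_def)
  moreover have "dim \<rat> F = 2"
    using dimI[OF Q dimF] by (simp add: over_def)
  ultimately show ?thesis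
    by (simp add: degree_over_Q_def)
qed

section \<open>The stabiliser of \<open>i\<close> as a proper subgroup containing the image\<close>

theorem proposition3p4:
  fixes \<delta> \<epsilon> k k\<^sub>\<epsilon> :: int
    and w :: "gen2 letter list"
    and Qbar :: "'a::field_char_0 ring"
    and K :: "'a set"
  assumes "\<delta> \<in> {1, -1}"
    and "\<epsilon> \<in> {1, -1}"
    and "of_int k\<^sub>\<epsilon> = (of_int k - 1 / 2 + of_int \<epsilon> / 2 :: rat)"
    and "k\<^sub>\<epsilon> \<ge> 1"
    and "\<not> [k\<^sub>\<epsilon> = 1] (mod 3)"
    and "w \<in> {x1 [^]\<^bsub>F2\<^esub> (2 * \<epsilon>) \<otimes>\<^bsub>F2\<^esub> y_word \<delta> k,
              x1 [^]\<^bsub>F2\<^esub> (2::int) \<otimes>\<^bsub>F2\<^esub> y_word \<delta> (\<epsilon> * k)}"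
    and "Qbar = ring_of_type_algebra"
    and "algebraic_closure Qbar \<rat>"
    and "number_field K"
    and "coprime (degree_over_Q K) 6"
  shows "word_map (galois_group Qbar K) w
           ` (carrier (galois_group Qbar K) \<times> carrier (galois_group Qbar K))
         \<noteq> carrier (galois_group Qbar K)"
proof -
  let ?L = "ring_of_type_algebra :: 'a ring"
  let ?G = "galois_group ?L K"
  have closure: "algebraic_closure ?L \<rat>"
    using assms(7,8) by simp
  then interpret L: algebraic_closure ?L \<rat> .
  have Q: "subfield \<rat> ?L"
    by (rule L.subfield_axioms)
  have alg: "algebraic x" for x :: 'a
    using closure by (rule algebraic_closure_Rats_algebraic)
  have closed: "\<exists>x. poly p x = 0" if "Polynomial.degree p > 0" for p :: "'a poly"
    using L.algebraically_closed_axioms that by (rule algebraically_closed_type_root)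
  obtain i :: 'a where "poly [:1, 0, 1:] i = 0"
    using closed[of "[:1, 0, 1:]"] by auto
  then have i: "i * i = -1"
    by (simp add: eq_neg_iff_add_eq_0 add.commute)
  then have "i \<noteq> 0"
    by auto
  have "odd (degree_over_Q K)"
    using assms(10) by (metis coprime_common_divisor dvd_refl even_numeral odd_one)
  then have "i \<notin> K"
    using even_degree_over_Q[OF Q assms(9) _ i] by blast
  have Kf: "subfield K ?L" and fin: "L.finite_dimension \<rat> K"
    using assms(9) by (auto simp: number_field_def)
  note K = subfield_type_closed[OF Kf]
  have "\<rat> \<subseteq> K"
    using subalgebra.smult_closed[OF L.finite_dimension_imp_subalgebra[OF Q fin] _ K(2)] by auto
  obtain \<sigma> :: "'a \<Rightarrow> 'a" where \<sigma>: "bij \<sigma>" "\<And>x y. \<sigma> (x + y) = \<sigma> x + \<sigma> y"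
    "\<And>x y. \<sigma> (x * y) = \<sigma> x * \<sigma> y" "\<And>x. x \<in> K \<Longrightarrow> \<sigma> x = x" "\<sigma> i = - i"
    by (rule conjugation_extends[OF \<open>\<rat> \<subseteq> K\<close> K(3,4,5) i \<open>i \<notin> K\<close> alg closed])
      (assumption | rule that)+
  interpret G: group ?G
    by (rule group_galois_group) (auto intro: L.ring_axioms)
  \<comment> \<open>The carrier of the ring is the whole type, so the extensionality condition in
    \<open>Bij\<close> is vacuous.\<close>
  have G: "\<tau> \<in> carrier ?G \<longleftrightarrow> bij \<tau> \<and> \<tau> \<in> ring_hom ?L ?L \<and> (\<forall>x\<in>K. \<tau> x = x)" for \<tau>
    by (simp add: galois_group_def Bij_def)
  have mult: "(\<tau> \<otimes>\<^bsub>?G\<^esub> \<rho>) x = \<tau> (\<rho> x)" if "\<tau> \<in> carrier ?G" "\<rho> \<in> carrier ?G" for \<tau> \<rho> x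
    using that by (simp add: galois_group_def BijGroup_def compose_def)
  have one: "\<one>\<^bsub>?G\<^esub> x = x" for x
    by (simp add: galois_group_def BijGroup_def)
  define N where "N = {\<tau> \<in> carrier ?G. \<tau> i = i}"
  have "subgroup N ?G"
  proof (rule G.subgroupI)
    show "N \<subseteq> carrier ?G"
      by (auto simp: N_def)
    show "N \<noteq> {}"
      using one by (auto simp: N_def)
    \<comment> \<open>Evaluate the product of the inverse of \<tau> with \<tau> at \<open>i\<close>,
      using that \<tau> fixes \<open>i\<close>.\<close>
    show "inv\<^bsub>?G\<^esub> \<tau> \<in> N" if "\<tau> \<in> N" for \<tau>
      using that mult[of "inv\<^bsub>?G\<^esub> \<tau>" \<tau> i] one by (auto simp: N_def)
    show "\<tau> \<otimes>\<^bsub>?G\<^esub> \<rho> \<in> N" if "\<tau> \<in> N" "\<rho> \<in> N" for \<tau> \<rho>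
      using that mult by (auto simp: N_def)
  qed
  moreover have "\<tau> \<otimes>\<^bsub>?G\<^esub> \<tau> \<in> N" if "\<tau> \<in> carrier ?G" for \<tau>
  proof -
    have hom: "\<tau> (x + y) = \<tau> x + \<tau> y" "\<tau> (x * y) = \<tau> x * \<tau> y" "\<tau> 1 = 1" for x y
      using that ring_hom_add[of \<tau> ?L ?L] ring_hom_mult[of \<tau> ?L ?L] ring_hom_one[of \<tau> ?L ?L]
      by (auto simp: G)
    have zero: "\<tau> 0 = 0"
      using hom(1)[of 0 0] by simp
    have neg: "\<tau> (- x) = - \<tau> x" for x
      using hom(1)[of "- x" x] zero by (simp add: eq_neg_iff_add_eq_0)
    have "\<tau> i * \<tau> i = i * i"
      using hom(2)[of i i] neg[of 1] by (simp add: i hom(3))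
    then have "\<tau> i = i \<or> \<tau> i = - i"
      by (simp add: square_eq_iff)
    then have "\<tau> (\<tau> i) = i"
      using neg[of i] by auto
    then show ?thesis
      using that mult by (simp add: N_def)
  qed
  \<comment> \<open>The pair is (\<epsilon>, k) for the first word and (1, \<epsilon>k) for the
    second.\<close>
  moreover obtain a k' :: int where "w = x1 [^]\<^bsub>F2\<^esub> (2 * a) \<otimes>\<^bsub>F2\<^esub> y_word \<delta> k'"
    using assms(6) that[of \<epsilon> k] that[of 1 "\<epsilon> * k"] by auto
  ultimately have image: "word_map ?G w (\<tau>, \<rho>) \<in> N"
    if "\<tau> \<in> carrier ?G" "\<rho> \<in> carrier ?G" for \<tau> \<rho>
    using that by (intro G.word_map_in_subgroup)
  have "\<sigma> \<in> ring_hom ?L ?L"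
    using \<sigma>(2,3) \<sigma>(4)[OF K(2)] by (simp add: ring_hom_def)
  then have "\<sigma> \<in> carrier ?G"
    using \<sigma>(1,4) by (simp add: G)
  \<comment> \<open>In characteristic 0 a nonzero \<open>i\<close> differs from
    \<open>- i\<close>.\<close>
  moreover have "\<sigma> \<notin> N"
    using \<sigma>(5) \<open>i \<noteq> 0\<close> by (simp add: N_def)
  moreover have "word_map ?G w ` (carrier ?G \<times> carrier ?G) \<subseteq> N"
    using image by auto
  ultimately show ?thesis
    unfolding assms(7) by blast
qed

end
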